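(* Let $G$ be a connected graph. Then $$DSO(G)\geq \frac{(R(G))^2}{BSO(G)}.$$
   Context: For a simple graph $G=(V,E)$, $d_u$ denotes the degree of vertex $u$. The Diminished Sombor index is $DSO(G)=\sum_{uv\in E}\frac{\sqrt{d_u^2+d_v^2}}{d_u+d_v}$. The Randić index is $R(G)=\sum_{uv\in E}\frac{1}{\sqrt{d_ud_v}}$, and the first Banhatti–Sombor index is $BSO(G)=\sum_{uv\in E}\sqrt{\frac{1}{d_u^2}+\frac{1}{d_v^2}}$. *)

theory Defs
  imports Complex_Main "Graph_Theory.Graph_Theory"
begin

text \<open>
  A finite simple graph is an instance of the locale \<^locale>\<open>graph\<close>: a finite symmetric digraph
  without loops and without parallel arcs.  An undirected edge $uv$ is therefore represented by
  the two arcs $(u,v)$ and $(v,u)$, and the degree of a vertex is its out-degree (which by symmetry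
  is also its in-degree).  To count every edge once, sums over $E$ range over the unordered pairs
  below.
\<close>

definition uedges :: "('a, 'b) pre_digraph \<Rightarrow> 'a set set" where
  "uedges G = {{tail G a, head G a} | a. a \<in> arcs G}"

abbreviation deg :: "('a, 'b) pre_digraph \<Rightarrow> 'a \<Rightarrow> real" where
  "deg G u \<equiv> real (out_degree G u)"

text \<open>
  Each summand is symmetric in the endpoints $u \neq v$ of the edge $e = \{u,v\}$, so that
  $d_u + d_v$ is the sum over \<open>w \<in> e\<close> of $d_w$, and similarly for the other expressions.
\<close>

definition DSO :: "('a, 'b) pre_digraph \<Rightarrow> real" where
  "DSO G = (\<Sum>e\<in>uedges G. sqrt (\<Sum>w\<in>e. (deg G w)\<^sup>2) / (\<Sum>w\<in>e. deg G w))"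

definition Randic :: "('a, 'b) pre_digraph \<Rightarrow> real" where
  "Randic G = (\<Sum>e\<in>uedges G. 1 / sqrt (\<Prod>w\<in>e. deg G w))"

definition BSO :: "('a, 'b) pre_digraph \<Rightarrow> real" where
  "BSO G = (\<Sum>e\<in>uedges G. sqrt (\<Sum>w\<in>e. 1 / (deg G w)\<^sup>2))"

end

theory Submission
  imports Defs "HOL-Analysis.Convex"
begin

text \<open>
  On an edge \<open>uv\<close> with \<open>x = d\<^sub>u\<close> and \<open>y = d\<^sub>v\<close>, the summands of \<open>DSO\<close> and \<open>BSO\<close> multiply to
  \<open>(x\<^sup>2 + y\<^sup>2) / ((x + y) x y)\<close>, which is at least the square \<open>1 / (x y)\<close> of the Randic summand,
  because \<open>x, y \<ge> 1\<close> gives \<open>x\<^sup>2 + y\<^sup>2 \<ge> x + y\<close>. The Cauchy-Schwarz inequality sums this over the edges.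
\<close>

text \<open>Cauchy-Schwarz for the families \<open>sqrt (a i)\<close> and \<open>sqrt (b i)\<close>,
  whose termwise products dominate \<open>c i\<close>.\<close>

lemma sum_squared_le_mult_sum:
  fixes a b c :: "'a \<Rightarrow> real"
  assumes "\<And>i. i \<in> I \<Longrightarrow> 0 \<le> a i" and "\<And>i. i \<in> I \<Longrightarrow> 0 \<le> b i"
    and "\<And>i. i \<in> I \<Longrightarrow> 0 \<le> c i" and "\<And>i. i \<in> I \<Longrightarrow> (c i)\<^sup>2 \<le> a i * b i"
  shows "(\<Sum>i\<in>I. c i)\<^sup>2 \<le> (\<Sum>i\<in>I. a i) * (\<Sum>i\<in>I. b i)"
proof -
  have "(\<Sum>i\<in>I. c i) \<le> (\<Sum>i\<in>I. sqrt (a i) * sqrt (b i))"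
    using assms by (intro sum_mono) (simp flip: real_sqrt_mult add: real_le_rsqrt)
  then have "(\<Sum>i\<in>I. c i)\<^sup>2 \<le> (\<Sum>i\<in>I. sqrt (a i) * sqrt (b i))\<^sup>2"
    using assms(3) by (intro power_mono sum_nonneg) auto
  also have "\<dots> \<le> (\<Sum>i\<in>I. (sqrt (a i))\<^sup>2) * (\<Sum>i\<in>I. (sqrt (b i))\<^sup>2)"
    by (rule Cauchy_Schwarz_ineq_sum)
  also have "\<dots> = (\<Sum>i\<in>I. a i) * (\<Sum>i\<in>I. b i)"
    using assms(1,2) by simp
  finally show ?thesis .
qed

lemma inverse_mult_le_Sombor_summands:
  fixes x y :: real
  assumes "1 \<le> x" "1 \<le> y"
  shows "(1 / sqrt (x * y))\<^sup>2 \<le> sqrt (x\<^sup>2 + y\<^sup>2) / (x + y) * sqrt (1 / x\<^sup>2 + 1 / y\<^sup>2)"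
proof -
  have pos: "0 < x" "0 < y" using assms by auto
  \<comment> \<open>Over a common denominator both radicands contain
    \<open>x\<^sup>2 + y\<^sup>2\<close>, so the product of the two roots is free of roots.\<close>
  have "1 / x\<^sup>2 + 1 / y\<^sup>2 = (x\<^sup>2 + y\<^sup>2) / (x * y)\<^sup>2"
    using pos by (simp add: field_simps)
  then have "sqrt (x\<^sup>2 + y\<^sup>2) / (x + y) * sqrt (1 / x\<^sup>2 + 1 / y\<^sup>2)
      = (x\<^sup>2 + y\<^sup>2) / (x + y) * (1 / (x * y))"
    using pos by (simp add: real_sqrt_divide)
  moreover have "x \<le> x\<^sup>2" "y \<le> y\<^sup>2"
    using assms by (simp_all add: self_le_power)
  then have "1 \<le> (x\<^sup>2 + y\<^sup>2) / (x + y)"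
    using pos by simp
  then have "1 * (1 / (x * y)) \<le> (x\<^sup>2 + y\<^sup>2) / (x + y) * (1 / (x * y))"
    using pos by (intro mult_right_mono) auto
  ultimately show ?thesis
    using pos by (simp add: power_divide)
qed

lemma (in fin_digraph) out_degree_tail_pos:
  assumes "a \<in> arcs G"
  shows "0 < out_degree G (tail G a)"
  using assms by (auto simp: out_degree_def card_gt_0_iff)

text \<open>An arc gives its tail positive out-degree; the reverse arc, present by symmetry, does so
  for its head.\<close>

lemma (in graph) uedgesE:
  assumes "e \<in> uedges G"
  obtains u v where "e = {u, v}" "u \<noteq> v" "1 \<le> deg G u" "1 \<le> deg G v"
proof -
  obtain a where a: "a \<in> arcs G" "e = {tail G a, head G a}"
    using assms by (auto simp: uedges_def)
  then have "(tail G a, head G a) \<in> arcs_ends G"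
    by (auto simp: arcs_ends_def arc_to_ends_def)
  then have "(head G a, tail G a) \<in> arcs_ends G"
    by (rule graph_symmetric)
  then obtain b where "b \<in> arcs G" "tail G b = head G a"
    by (auto simp: arcs_ends_def arc_to_ends_def)
  then have "0 < out_degree G (head G a)"
    using out_degree_tail_pos by metis
  then show ?thesis
    using that[of "tail G a" "head G a"] a no_loops out_degree_tail_pos[of a] by auto
qed

theorem theorem3p9:
  fixes G :: "('a, 'b) pre_digraph"
  assumes "graph G"
    and "Digraph_Component.connected G"
  shows "DSO G \<ge> (Randic G)\<^sup>2 / BSO G"
proof -
  interpret graph G by fact
  have "(Randic G)\<^sup>2 \<le> DSO G * BSO G"
    unfolding Randic_def DSO_def BSO_def
  proof (rule sum_squared_le_mult_sum)
    fix e assume "e \<in> uedges G"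
    then show "(1 / sqrt (\<Prod>w\<in>e. deg G w))\<^sup>2 \<le>
        sqrt (\<Sum>w\<in>e. (deg G w)\<^sup>2) / (\<Sum>w\<in>e. deg G w) * sqrt (\<Sum>w\<in>e. 1 / (deg G w)\<^sup>2)"
      \<comment> \<open>Since \<open>u \<noteq> v\<close>, the sums and the product over
        \<open>e = {u, v}\<close> have exactly the two terms that the inequality in \<open>x\<close>
        and \<open>y\<close> expects.\<close>
      by (elim uedgesE) (use inverse_mult_le_Sombor_summands in simp)
  qed (auto intro!: divide_nonneg_nonneg sum_nonneg prod_nonneg)
  moreover have "0 \<le> DSO G" "0 \<le> BSO G"
    by (auto simp: DSO_def BSO_def intro!: sum_nonneg divide_nonneg_nonneg)
  \<comment> \<open>An edgeless \<open>G\<close> has \<open>BSO G = 0\<close>, where the quotient is \<open>0\<close> by convention.\<close>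
  ultimately show ?thesis
    by (cases "BSO G = 0") (auto simp: pos_divide_le_eq)
qed

end
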